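(* Let $p\in(0,1)$ and let $f\in\mathcal{A}(p)$. If $|U_f(z)|<1$ holds for all $z\in\mathbb{D}$, then $f\in\Sigma(p)$; that is, $f$ is univalent (one-to-one) in $\mathbb{D}$.
   Context: $\mathbb{D}=\{z\in\mathbb{C}:|z|<1\}$. For $p\in(0,1)$, $\mathcal{A}(p)$ is the class of all functions $f$ that are holomorphic in $\mathbb{D}\setminus\{p\}$, have a simple pole at $z=p$ (with nonzero residue), and satisfy $f(0)=0$ and $f'(0)=1$. $\Sigma(p)$ is the set of $f\in\mathcal{A}(p)$ that are one-to-one in $\mathbb{D}$ (as maps into the Riemann sphere, with $f(p)=\infty$). For $f\in\mathcal{A}(p)$ put $U_f(z)=\left(\frac{z}{f(z)}\right)^2 f'(z)-1$, regarded as a meromorphic function on $\mathbb{D}$ with removable singularities (in particular at $z=0$ and $z=p$) filled in; a bound $|U_f(z)|<c$ for all $z\in\mathbb{D}$ includes the requirement that $U_f$ has no poles in $\mathbb{D}$. *)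

theory Defs
  imports "HOL-Complex_Analysis.Complex_Analysis"
begin

(* The value of f at its pole p is an arbitrary complex number and is never used.
   A pole of order 1 automatically has nonzero residue. *)
definition class_A :: "real \<Rightarrow> (complex \<Rightarrow> complex) set" where
  "class_A p = {f. f holomorphic_on (ball 0 1 - {of_real p}) \<and>
                   is_pole f (of_real p) \<and> zorder f (of_real p) = -1 \<and>
                   f 0 = 0 \<and> deriv f 0 = 1}"

(* The Riemann sphere is represented as complex option, with None as the point at infinity
   (as in Alexandroff_compactification). *)
definition sphere_map :: "real \<Rightarrow> (complex \<Rightarrow> complex) \<Rightarrow> complex \<Rightarrow> complex option" where
  "sphere_map p f z = (if z = of_real p then None else Some (f z))"

definition class_Sigma :: "real \<Rightarrow> (complex \<Rightarrow> complex) set" where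
  "class_Sigma p = {f \<in> class_A p. inj_on (sphere_map p f) (ball 0 1)}"

(* remove_sings yields 0 at a pole, so a bound on norm (U_fun f z) alone does not
   exclude poles of U_fun f. *)
definition U_fun :: "(complex \<Rightarrow> complex) \<Rightarrow> complex \<Rightarrow> complex" where
  "U_fun f = remove_sings (\<lambda>z. (z / f z)\<^sup>2 * deriv f z - 1)"

end

theory Submission
  imports Defs
begin

text \<open>
  The function \<open>h z = 1 / f z - 1 / z\<close> extends holomorphically to the whole disc, and
  \<open>U_f z = - z\<^sup>2 h'(z)\<close>. The bound on \<open>U_f\<close> and the maximum principle on circles of radius
  tending to 1 give \<open>norm (h' z) \<le> 1\<close>, so \<open>h\<close> is 1-Lipschitz. If \<open>f z = f w\<close> with \<open>z \<noteq> w\<close>, then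
  \<open>norm (h z - h w) = norm (z - w) / norm (z * w) > norm (z - w)\<close>, a contradiction. Zeros of \<open>f\<close> other than 0 would be
  poles of \<open>U_f\<close>.
\<close>

text \<open>Up to sign this function is the derivative of 1/f. The zero of f is a pole of 1/f, and
  differentiating a meromorphic function keeps its poles.\<close>

lemma is_pole_deriv_inverse_at_zero:
  fixes f :: "complex \<Rightarrow> complex"
  assumes f: "f analytic_on {z}" "f z = 0" and nz: "\<forall>\<^sub>F w in at z. f w \<noteq> 0"
  shows "is_pole (\<lambda>w. deriv f w / (f w)\<^sup>2) z"
proof -
  have "f \<midarrow>z\<rightarrow> 0"
    using f analytic_at_imp_isCont isCont_def by metis
  with nz have "filterlim f (at 0) (at z)"
    by (simp add: filterlim_at)
  then have "is_pole (\<lambda>w. inverse (f w)) z"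
    unfolding is_pole_def by (rule filterlim_compose[OF filterlim_inverse_at_infinity])
  moreover have "(\<lambda>w. inverse (f w)) meromorphic_on {z}"
    using f by (intro meromorphic_intros analytic_on_imp_meromorphic_on)
  ultimately have "is_pole (deriv (\<lambda>w. inverse (f w))) z"
    by (simp add: is_pole_deriv_iff)
  then have "is_pole (\<lambda>w. - deriv (\<lambda>w. inverse (f w)) w) z"
    by simp
  moreover have "\<forall>\<^sub>F w in at z. - deriv (\<lambda>w. inverse (f w)) w = deriv f w / (f w)\<^sup>2"
  proof -
    obtain S where S: "open S" "z \<in> S" "f holomorphic_on S"
      using f by (auto simp: analytic_at)
    then have "\<forall>\<^sub>F w in at z. w \<in> S"
      by (intro eventually_at_in_open')
    then have "\<forall>\<^sub>F w in at z. f analytic_on {w}"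
      by eventually_elim (use S in \<open>auto intro: holomorphic_on_imp_analytic_at\<close>)
    with nz show ?thesis
    proof eventually_elim
      case (elim w)
      then have "(f has_field_derivative deriv f w) (at w)"
        by (simp add: analytic_derivI)
      then have "((\<lambda>w. inverse (f w)) has_field_derivative
                   - (inverse (f w) * deriv f w * inverse (f w))) (at w)"
        using elim by (intro DERIV_inverse') auto
      then show ?case
        by (simp add: DERIV_imp_deriv power2_eq_square field_simps)
    qed
  qed
  ultimately show ?thesis
    by (rule is_pole_transform) simp
qed

text \<open>Away from the origin the factor \<open>w\<^sup>2\<close> has a nonzero limit, so the
  pole of f'/f^2 survives. At 0 it would cancel the double pole coming from a simple zero, hence
  \<open>z \<noteq> 0\<close>.\<close>

lemma is_pole_U_fun_at_zero:
  fixes f :: "complex \<Rightarrow> complex"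
  assumes "f analytic_on {z}" "f z = 0" "\<forall>\<^sub>F w in at z. f w \<noteq> 0" "z \<noteq> 0"
  shows "is_pole (U_fun f) z"
proof -
  let ?u = "\<lambda>w. (w / f w)\<^sup>2 * deriv f w - 1"
  have "filterlim (\<lambda>w. w\<^sup>2 * (deriv f w / (f w)\<^sup>2)) at_infinity (at z)"
    using is_pole_deriv_inverse_at_zero[OF assms(1-3)] \<open>z \<noteq> 0\<close> unfolding is_pole_def
    by (intro tendsto_mult_filterlim_at_infinity[where c = "z\<^sup>2"]) (auto intro!: tendsto_eq_intros)
  then have "is_pole (\<lambda>w. (w / f w)\<^sup>2 * deriv f w) z"
    by (simp add: is_pole_def power_divide)
  then have "is_pole ?u z"
    by (subst (asm) is_pole_plus_const_iff[where c = "-1"]) simp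
  moreover have "?u meromorphic_on {z}"
    using assms by (intro meromorphic_intros analytic_on_imp_meromorphic_on analytic_intros) auto
  ultimately show ?thesis
    unfolding U_fun_def
    by (metis is_pole_remove_sings_iff meromorphic_on_isolated_singularity meromorphic_on_not_essential singletonI)
qed

text \<open>Circles of radius close to 1 suffice for the maximum principle, so \<open>bound\<close>
  only concerns norms above \<open>p\<close>. It thus stays clear of 0 and of the pole, where the
  formula for U_f in terms of h' is not established.\<close>

lemma norm_le_1_if_quadratic_bound:
  fixes g :: "complex \<Rightarrow> complex"
  assumes holo: "g holomorphic_on ball 0 1" and p: "0 < p" "p < 1"
    and bound: "\<And>z. norm z < 1 \<Longrightarrow> p < norm z \<Longrightarrow> norm (z\<^sup>2 * g z) \<le> 1"
    and z: "norm z < 1"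
  shows "norm (g z) \<le> 1"
proof (rule tendsto_lowerbound)
  show "((\<lambda>r. 1 / r\<^sup>2) \<longlongrightarrow> (1::real)) (at_left 1)"
    by (auto intro!: tendsto_eq_intros)
  \<comment> \<open>A radius above \<open>p\<close> makes \<open>bound\<close> available on the
    circle; one above \<open>norm z\<close> puts \<open>z\<close> inside it.\<close>
  have "\<forall>\<^sub>F r in at_left (1::real). r \<in> {max p (norm z)<..<1}"
    using p z by (intro eventually_at_leftI[of "max p (norm z)"]) auto
  then show "\<forall>\<^sub>F r in at_left (1::real). norm (g z) \<le> 1 / r\<^sup>2"
  proof eventually_elim
    case (elim r)
    have "0 < r" "r < 1" "p < r" "norm z < r"
      using elim p by auto
    show ?case
    proof (rule maximum_modulus_frontier[where S = "cball 0 r" and f = g])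
      show "g holomorphic_on interior (cball 0 r)"
        using \<open>r < 1\<close> by (auto intro!: holomorphic_on_subset[OF holo])
      show "continuous_on (closure (cball 0 r)) g"
        using \<open>r < 1\<close> by (auto intro!: holomorphic_on_imp_continuous_on holomorphic_on_subset[OF holo])
      show "norm (g w) \<le> 1 / r\<^sup>2" if "w \<in> frontier (cball 0 r)" for w
        using bound[of w] that \<open>0 < r\<close> \<open>r < 1\<close> \<open>p < r\<close> by (auto simp: norm_mult norm_power field_simps)
    qed (use \<open>norm z < r\<close> in auto)
  qed
qed simp

context
  fixes p :: real and f :: "complex \<Rightarrow> complex"
  assumes p: "0 < p" "p < 1"
    and f: "f \<in> class_A p"
    and U: "\<And>z. z \<in> ball 0 1 \<Longrightarrow> \<not> is_pole (U_fun f) z \<and> norm (U_fun f z) < 1"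
begin

lemma f_analytic_at: "f analytic_on {z}" if "norm z < 1" "z \<noteq> of_real p"
proof -
  have "f holomorphic_on (ball 0 1 - {of_real p})"
    using f by (simp add: class_A_def)
  then show ?thesis
    using that by (intro holomorphic_on_imp_analytic_at[of _ "ball 0 1 - {of_real p}"]) auto
qed

lemma f_nonzero: "f z \<noteq> 0" if z: "norm z < 1" "z \<noteq> of_real p" "z \<noteq> 0"
proof
  assume "f z = 0"
  let ?S = "ball 0 1 - {of_real p} :: complex set"
  have conn: "connected ?S"
    by (intro connected_open_delete) auto
  have holo: "f holomorphic_on ?S" and "is_pole f (of_real p)"
    using f by (auto simp: class_A_def)
  \<comment> \<open>The pole forces f to be nonzero at some nearby point \<open>b\<close>. Since the
    punctured disc is connected, the identity theorem then makes the supposed zero isolated.\<close>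
  then have "\<forall>\<^sub>F w in at (of_real p). f w \<noteq> 0"
    by (simp add: non_zero_neighbour_pole)
  moreover have "\<forall>\<^sub>F w in at (of_real p). w \<in> ?S"
    using p by (intro eventually_at_in_open) auto
  ultimately have "\<forall>\<^sub>F w in at (of_real p :: complex). f w \<noteq> 0 \<and> w \<in> ?S"
    by (rule eventually_conj)
  then obtain b where "f b \<noteq> 0" "b \<in> ?S"
    using eventually_happens[of _ "at (of_real p :: complex)"] by auto
  then have "\<forall>\<^sub>F w in at z. f w \<noteq> 0"
    using z holo conn \<open>f z = 0\<close> non_zero_neighbour_alt[of f ?S z b] \<open>f b \<noteq> 0\<close> \<open>b \<in> ?S\<close>
    by (auto simp: open_Diff elim: eventually_mono)
  then show False
    using is_pole_U_fun_at_zero[OF f_analytic_at \<open>f z = 0\<close>] U[of z] z by simp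
qed

text \<open>The function Q(z) = z/f(z) is holomorphic in the whole disc, because f(z)/z has no zeros
  and its only singularity is a pole. As Q(0) = 1/f'(0) = 1, the difference quotient of Q at 0 is
  1/f(z) - 1/z.\<close>

lemma reciprocal_difference_extends:
  obtains h where "h holomorphic_on ball 0 1"
    "\<And>z. norm z < 1 \<Longrightarrow> z \<noteq> 0 \<Longrightarrow> z \<noteq> of_real p \<Longrightarrow> h z = 1 / f z - 1 / z"
proof -
  let ?S = "ball 0 1 - {of_real p} :: complex set"
  define k where "k = (\<lambda>z. if z = 0 then deriv f 0 else f z / z)"
  \<comment> \<open>The value 0 is the limit of 1/k at the pole, so it fills the removable
    singularity.\<close>
  define Q where "Q = (\<lambda>z. if z = of_real p then 0 else inverse (k z))"
  have f': "f holomorphic_on ?S" "is_pole f (of_real p)" "f 0 = 0" "deriv f 0 = 1"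
    using f by (auto simp: class_A_def)
  have "k holomorphic_on ?S"
    using pole_lemma_open[OF f'(1), of 0] f'(3) by (simp add: k_def open_Diff cong: if_cong)
  moreover have "is_pole k (of_real p)"
  proof (rule is_pole_transform)
    have "filterlim (\<lambda>z. inverse z * f z) at_infinity (at (of_real p))"
      using f'(2) p unfolding is_pole_def
      by (intro tendsto_mult_filterlim_at_infinity[where c = "inverse (of_real p)"])
         (auto intro!: tendsto_eq_intros)
    then show "is_pole (\<lambda>z. inverse z * f z) (of_real p)"
      by (simp add: is_pole_def)
    have "\<forall>\<^sub>F z in at (of_real p :: complex). z \<in> - {0} - {of_real p}"
      using p by (intro eventually_at_in_open) auto
    then show "\<forall>\<^sub>F z in at (of_real p). inverse z * f z = k z"
      by eventually_elim (auto simp: k_def field_simps)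
  qed simp
  moreover have "\<forall>z\<in>?S. k z \<noteq> 0"
    using f_nonzero f'(4) by (auto simp: k_def)
  ultimately have "Q holomorphic_on ball 0 1"
    unfolding Q_def by (intro is_pole_inverse_holomorphic) auto
  then have "(\<lambda>z. if z = 0 then deriv Q 0 else (Q z - Q 0) / (z - 0)) holomorphic_on ball 0 1"
    by (intro pole_lemma) auto
  moreover have "(Q z - Q 0) / (z - 0) = 1 / f z - 1 / z"
    if "norm z < 1" "z \<noteq> 0" "z \<noteq> of_real p" for z
    using that p f_nonzero[of z] f'(4) by (simp add: Q_def k_def field_simps)
  ultimately show thesis
    by (intro that[of "\<lambda>z. if z = 0 then deriv Q 0 else (Q z - Q 0) / (z - 0)"]) auto
qed

lemma U_fun_eq_deriv:
  assumes h: "\<And>z. norm z < 1 \<Longrightarrow> z \<noteq> 0 \<Longrightarrow> z \<noteq> of_real p \<Longrightarrow> h z = 1 / f z - 1 / z"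
    and z: "norm z < 1" "z \<noteq> 0" "z \<noteq> of_real p"
  shows "U_fun f z = - (z\<^sup>2 * deriv h z)"
proof -
  have fz: "f z \<noteq> 0" and an: "f analytic_on {z}"
    using f_nonzero f_analytic_at z by auto
  \<comment> \<open>At a point of analyticity \<open>remove_sings\<close> leaves the value
    unchanged.\<close>
  have "(\<lambda>z. (z / f z)\<^sup>2 * deriv f z - 1) analytic_on {z}"
    using an fz by (intro analytic_intros) auto
  then have U: "U_fun f z = (z / f z)\<^sup>2 * deriv f z - 1"
    by (simp add: U_fun_def)
  have "((\<lambda>z. 1 / f z - 1 / z) has_field_derivative
                   - (deriv f z / (f z)\<^sup>2) + 1 / z\<^sup>2) (at z)"
    using fz z analytic_derivI[OF an]
    by (auto intro!: derivative_eq_intros simp: power2_eq_square)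
  then have "(h has_field_derivative - (deriv f z / (f z)\<^sup>2) + 1 / z\<^sup>2) (at z)"
    using z h
    by (elim has_field_derivative_transform_within_open[where S = "ball 0 1 - {0, of_real p}"])
       (auto simp: open_Diff)
  then have h': "deriv h z = - (deriv f z / (f z)\<^sup>2) + 1 / z\<^sup>2"
    by (rule DERIV_imp_deriv)
  show ?thesis
    unfolding U h' using fz z by (simp add: field_simps)
qed

lemma f_inj:
  assumes "norm z < 1" "z \<noteq> of_real p" "norm w < 1" "w \<noteq> of_real p" "f z = f w"
  shows "z = w"
proof (rule ccontr)
  assume "z \<noteq> w"
  have "f 0 = 0"
    using f by (simp add: class_A_def)
  \<comment> \<open>If one point were 0, the other would be a second zero of f.\<close>
  with assms \<open>z \<noteq> w\<close> f_nonzero have nz: "z \<noteq> 0" "w \<noteq> 0"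
    by metis+
  obtain h where h: "h holomorphic_on ball 0 1"
    "\<And>z. norm z < 1 \<Longrightarrow> z \<noteq> 0 \<Longrightarrow> z \<noteq> of_real p \<Longrightarrow> h z = 1 / f z - 1 / z"
    using reciprocal_difference_extends by blast
  have "norm (deriv h \<zeta>) \<le> 1" if "norm \<zeta> < 1" for \<zeta>
  proof (rule norm_le_1_if_quadratic_bound[OF _ p _ that])
    show "deriv h holomorphic_on ball 0 1"
      using h(1) by (intro holomorphic_deriv) auto
    show "norm (\<xi>\<^sup>2 * deriv h \<xi>) \<le> 1" if "norm \<xi> < 1" "p < norm \<xi>" for \<xi>
    proof -
      have "\<xi> \<noteq> 0" "\<xi> \<noteq> of_real p"
        using that p by auto
      then have "norm (\<xi>\<^sup>2 * deriv h \<xi>) = norm (U_fun f \<xi>)"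
        using U_fun_eq_deriv[OF h(2)] that by simp
      then show ?thesis
        using U[of \<xi>] that by simp
    qed
  qed
  \<comment> \<open>The disc is convex, so the derivative bound integrates along the segment from
    \<open>z\<close> to \<open>w\<close>.\<close>
  then have "norm (h w - h z) \<le> 1 * norm (w - z)"
    using assms h(1)
    by (intro field_differentiable_bound[where S = "ball 0 1" and f' = "deriv h"])
       (auto intro!: holomorphic_derivI)
  \<comment> \<open>The terms 1/f cancel because \<open>f z = f w\<close>.\<close>
  moreover have "h w - h z = 1 / z - 1 / w"
    using assms h(2) nz by simp
  then have "h w - h z = (w - z) / (w * z)"
    using nz by (simp add: field_simps)
  ultimately have "norm (w - z) \<le> norm (w - z) * (norm w * norm z)"
    using nz by (simp add: norm_divide norm_mult field_simps)
  moreover have "norm w * norm z < 1 * 1"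
    using assms nz by (intro mult_strict_mono) auto
  ultimately show False
    using \<open>z \<noteq> w\<close> by (simp add: mult_le_cancel_left1)
qed

end

theorem theorem1:
  fixes p :: real and f :: "complex \<Rightarrow> complex"
  assumes "0 < p" and "p < 1"
    and "f \<in> class_A p"
    and "\<And>z. z \<in> ball 0 1 \<Longrightarrow> \<not> is_pole (U_fun f) z \<and> norm (U_fun f z) < 1"
  shows "f \<in> class_Sigma p"
proof -
  have "inj_on (sphere_map p f) (ball 0 1)"
    \<comment> \<open>Only the pole is sent to \<open>None\<close>, so just pairs of points other
      than it remain.\<close>
    by (intro inj_onI) (auto simp: sphere_map_def split: if_splits intro: f_inj[OF assms])
  with assms(3) show ?thesis
    by (simp add: class_Sigma_def)
qed

end
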